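(* Let $G$ and $H$ be finite simple undirected graphs such that $I_{G\to H}$ is unmixed. Then for every integer $k\geq 1$, one has $I_{G\to H}^{(k)}=I_{G\to H}^k$.
   Context: All graphs are finite, simple, undirected, with nonempty vertex sets. Let $V(G)=[n]=\{1,\dots,n\}$ and $V(H)=[m]$. A weak homomorphism from $G$ to $H$ is a map $\phi:V(G)\to V(H)$ such that for every $\{x,y\}\in E(G)$ either $\phi(x)=\phi(y)$ or $\{\phi(x),\phi(y)\}\in E(H)$; the set of these is $\mathrm{WHom}(G,H)$. Let $K$ be a field and $S=K[x_{ij}: i\in[n], j\in[m]]$. For $\phi\in\mathrm{WHom}(G,H)$ put $u_\phi=\prod_{i=1}^n x_{i\phi(i)}$, and $I_{G\to H}=(u_\phi:\phi\in\mathrm{WHom}(G,H))\subseteq S$, a squarefree monomial ideal. A monomial ideal is unmixed if all its associated primes have the same height. For a squarefree monomial ideal $I$ with irredundant primary decomposition $I=\mathfrak p_1\cap\cdots\cap\mathfrak p_r$ (each $\mathfrak p_i$ generated by a subset of the variables), the $k$th symbolic power is $I^{(k)}=\mathfrak p_1^k\cap\cdots\cap\mathfrak p_r^k$. *)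

theory Defs
  imports
    "HOL-Library.Poly_Mapping"
    "HOL-Library.Extended_Nat"
    "HOL-Algebra.Ideal_Product"
    "HOL-Algebra.Algebraic_Closure_Type"
begin

section \<open>Graphs and weak homomorphisms\<close>

text \<open>A finite graph is given by its edge set; its vertices are all elements of a type of class
  \<open>finite\<close>, which is automatically nonempty.\<close>

definition simple_graph :: "'a::finite set set \<Rightarrow> bool"
  where "simple_graph E \<longleftrightarrow> (\<forall>e\<in>E. card e = 2)"

definition WHom :: "'a::finite set set \<Rightarrow> 'b::finite set set \<Rightarrow> ('a \<Rightarrow> 'b) set"
  where "WHom E F = {\<phi>. \<forall>x y. {x, y} \<in> E \<longrightarrow> \<phi> x = \<phi> y \<or> {\<phi> x, \<phi> y} \<in> F}"

section \<open>Heights, associated primes and unmixed ideals\<close>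

definition height :: "('r, 'm) ring_scheme \<Rightarrow> 'r set \<Rightarrow> enat"
  where "height R P = Sup {enat n | n. \<exists>C :: nat \<Rightarrow> 'r set.
           (\<forall>i\<le>n. primeideal (C i) R) \<and> (\<forall>i<n. C i \<subset> C (Suc i)) \<and> C n = P}"

text \<open>The associated primes of an ideal \<open>I\<close> are those of the module \<open>R/I\<close>, i.e. the prime ideals of
  the form \<open>I : f\<close>.\<close>

definition associated_primes :: "('r, 'm) ring_scheme \<Rightarrow> 'r set \<Rightarrow> 'r set set"
  where "associated_primes R I =
           {P. primeideal P R \<and>
               (\<exists>f \<in> carrier R. P = {g \<in> carrier R. g \<otimes>\<^bsub>R\<^esub> f \<in> I})}"

definition unmixed :: "('r, 'm) ring_scheme \<Rightarrow> 'r set \<Rightarrow> bool"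
  where "unmixed R I \<longleftrightarrow>
           (\<forall>P \<in> associated_primes R I. \<forall>Q \<in> associated_primes R I. height R P = height R Q)"

definition ideal_power :: "('r, 'm) ring_scheme \<Rightarrow> 'r set \<Rightarrow> nat \<Rightarrow> 'r set"
  where "ideal_power R I k = I [^]\<^bsub>ideals_set R\<^esub> k"

section \<open>Polynomial rings and symbolic powers\<close>

text \<open>Polynomials over \<open>'k\<close> in the variables \<open>'v\<close>: finitely supported functions on the
  monomials, which are in turn finitely supported exponent functions.\<close>

type_synonym ('v, 'k) mpoly = "('v \<Rightarrow>\<^sub>0 nat) \<Rightarrow>\<^sub>0 'k"

abbreviation mpoly_ring :: "('v, 'k::field) mpoly ring"
  where "mpoly_ring \<equiv> ring_of_type_algebra"

definition Var :: "'v \<Rightarrow> ('v, 'k::field) mpoly"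
  where "Var v = Poly_Mapping.single (Poly_Mapping.single v 1) 1"

definition irredundant_decomposition ::
  "('v, 'k::field) mpoly set \<Rightarrow> ('v, 'k) mpoly set set \<Rightarrow> bool"
  where "irredundant_decomposition I \<P> \<longleftrightarrow>
           finite \<P> \<and> (\<forall>\<pp>\<in>\<P>. \<exists>A. \<pp> = Idl\<^bsub>mpoly_ring\<^esub> (Var ` A)) \<and>
           I = \<Inter>\<P> \<and> (\<forall>\<pp>\<in>\<P>. \<Inter>(\<P> - {\<pp>}) \<noteq> I)"

text \<open>Intended for squarefree monomial ideals in finitely many variables, for which a decomposition
  as above exists and is unique (it consists of the minimal primes of \<open>I\<close>).\<close>

definition symbolic_power :: "('v, 'k::field) mpoly set \<Rightarrow> nat \<Rightarrow> ('v, 'k) mpoly set"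
  where "symbolic_power I k =
           (\<Inter>\<pp> \<in> (THE \<P>. irredundant_decomposition I \<P>). ideal_power mpoly_ring \<pp> k)"

section \<open>The ideal of weak homomorphisms\<close>

definition hom_monomial :: "('a::finite \<Rightarrow> 'b::finite) \<Rightarrow> ('a \<times> 'b, 'k::field) mpoly"
  where "hom_monomial \<phi> = (\<Prod>i\<in>UNIV. Var (i, \<phi> i))"

definition hom_ideal ::
  "'a::finite set set \<Rightarrow> 'b::finite set set \<Rightarrow> ('a \<times> 'b, 'k::field) mpoly set"
  where "hom_ideal E F = Idl\<^bsub>mpoly_ring\<^esub> (hom_monomial ` WHom E F)"

end

theory Submission
  imports Defs "HOL-Library.Cardinality"
begin

text \<open>The minimal primes of \<open>I\<close> are generated by the minimal sets \<open>C\<close> of variables that meet the graph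
  of every weak homomorphism, and the height of such a prime is \<open>card C\<close>. For a fixed
  vertex \<open>p\<close> of \<open>G\<close>, all variables \<open>x\<^bsub>pj\<^esub>\<close> form such a set, so unmixedness says that every \<open>C\<close> has as many elements as \<open>H\<close> has
  vertices. As \<open>C\<close> also meets the graphs of the constant maps, it is the graph of a function
  from \<open>V(H)\<close> to \<open>V(G)\<close>, and this forces every weak homomorphism to meet \<open>C\<close> exactly once.
  Hence, if a monomial has degree at least \<open>k + 1\<close> in every \<open>C\<close>, its support contains the graph of
  some weak homomorphism, and dividing by the corresponding generator lowers each of these degrees by
  exactly one; after \<open>k + 1\<close> such steps the monomial is seen to lie in \<open>I ^ (k + 1)\<close>.\<close>

section \<open>Ideals of a type-class ring\<close>

lemma ring_of_type_algebra_simps [simp]: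
  "carrier (ring_of_type_algebra :: 'r::comm_ring_1 ring) = UNIV"
  "monoid.mult (ring_of_type_algebra :: 'r ring) = (*)"
  "add (ring_of_type_algebra :: 'r ring) = (+)"
  "one (ring_of_type_algebra :: 'r ring) = 1"
  "zero (ring_of_type_algebra :: 'r ring) = 0"
  by (simp_all add: ring_of_type_algebra_def fun_eq_iff)

text \<open>Negation is multiplication by \<open>- 1\<close>, so absorption already gives closure
  under additive inverses.\<close>

lemma ideal_iff:
  "ideal I (ring_of_type_algebra :: 'r::comm_ring_1 ring) \<longleftrightarrow>
     0 \<in> I \<and> (\<forall>x\<in>I. \<forall>y\<in>I. x + y \<in> I) \<and> (\<forall>x\<in>I. \<forall>r. r * x \<in> I)"
proof
  assume "ideal I (ring_of_type_algebra :: 'r ring)"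
  then interpret ideal I "ring_of_type_algebra :: 'r ring" .
  show "0 \<in> I \<and> (\<forall>x\<in>I. \<forall>y\<in>I. x + y \<in> I) \<and> (\<forall>x\<in>I. \<forall>r. r * x \<in> I)"
    using additive_subgroup.zero_closed[OF is_additive_subgroup]
      additive_subgroup.a_closed[OF is_additive_subgroup] I_l_closed by auto
next
  assume *: "0 \<in> I \<and> (\<forall>x\<in>I. \<forall>y\<in>I. x + y \<in> I) \<and> (\<forall>x\<in>I. \<forall>r. r * x \<in> I)"
  interpret R: cring "ring_of_type_algebra :: 'r ring" by rule
  show "ideal I (ring_of_type_algebra :: 'r ring)"
  proof (rule idealI)
    show "ring (ring_of_type_algebra :: 'r ring)" by rule
    have "inv\<^bsub>add_monoid (ring_of_type_algebra :: 'r ring)\<^esub> x \<in> I" if "x \<in> I" for x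
    proof -
      have "inv\<^bsub>add_monoid (ring_of_type_algebra :: 'r ring)\<^esub> x = - x"
        using R.minus_equality[of "- x" x] by (simp add: a_inv_def)
      also have "\<dots> = (- 1) * x" by simp
      finally show ?thesis using * that by metis
    qed
    then show "subgroup I (add_monoid (ring_of_type_algebra :: 'r ring))"
      using * by (intro subgroup.intro) auto
  qed (use * in \<open>auto simp: mult.commute\<close>)
qed

lemma primeideal_iff:
  "primeideal P (ring_of_type_algebra :: 'r::comm_ring_1 ring) \<longleftrightarrow>
     ideal P (ring_of_type_algebra :: 'r ring) \<and> 1 \<notin> P \<and> (\<forall>a b. a * b \<in> P \<longrightarrow> a \<in> P \<or> b \<in> P)"
proof
  assume "primeideal P (ring_of_type_algebra :: 'r ring)"
  then interpret primeideal P "ring_of_type_algebra :: 'r ring" .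
  have "1 \<notin> P" using I_notcarr one_imp_carrier by auto
  then show "ideal P (ring_of_type_algebra :: 'r ring) \<and> 1 \<notin> P \<and>
      (\<forall>a b. a * b \<in> P \<longrightarrow> a \<in> P \<or> b \<in> P)"
    using is_ideal I_prime by auto
next
  assume *: "ideal P (ring_of_type_algebra :: 'r ring) \<and> 1 \<notin> P \<and>
    (\<forall>a b. a * b \<in> P \<longrightarrow> a \<in> P \<or> b \<in> P)"
  have "cring (ring_of_type_algebra :: 'r ring)" by rule
  with * show "primeideal P (ring_of_type_algebra :: 'r ring)"
    by (intro primeidealI) auto
qed

lemma ideal_sum_closed:
  assumes "ideal I (ring_of_type_algebra :: 'r::comm_ring_1 ring)" "\<And>x. x \<in> Y \<Longrightarrow> g x \<in> I"
  shows "sum g Y \<in> I"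
  using assms by (induction Y rule: infinite_finite_induct) (auto simp: ideal_iff)

lemma ideal_power_0: "ideal_power (ring_of_type_algebra :: 'r::comm_ring_1 ring) I 0 = UNIV"
  by (simp add: ideal_power_def ideals_set_def)

lemma ideal_power_Suc:
  "ideal_power (ring_of_type_algebra :: 'r::comm_ring_1 ring) I (Suc k) =
     ideal_prod ring_of_type_algebra (ideal_power ring_of_type_algebra I k) I"
  by (simp add: ideal_power_def ideals_set_def)

lemma ideal_power_ideal:
  assumes "ideal I (ring_of_type_algebra :: 'r::comm_ring_1 ring)"
  shows "ideal (ideal_power (ring_of_type_algebra :: 'r ring) I k) ring_of_type_algebra"
proof (induction k)
  case 0
  then show ?case by (simp add: ideal_power_0 ideal_iff)
next
  case (Suc k)
  have "ring (ring_of_type_algebra :: 'r ring)" by rule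
  with Suc assms show ?case
    by (simp add: ideal_power_Suc ring.ideal_prod_is_ideal)
qed

lemma ideal_power_mono:
  assumes "I \<subseteq> J"
  shows "ideal_power (ring_of_type_algebra :: 'r::comm_ring_1 ring) I k \<subseteq> ideal_power ring_of_type_algebra J k"
proof (induction k)
  case (Suc k)
  have "x \<in> ideal_prod ring_of_type_algebra (ideal_power ring_of_type_algebra J k) J"
    if "x \<in> ideal_prod ring_of_type_algebra (ideal_power ring_of_type_algebra I k) I" for x :: 'r
    using that
  proof induction
    case (prod i j)
    then show ?case using Suc assms by (intro ideal_prod.prod) auto
  next
    case (sum s1 s2)
    then show ?case by (intro ideal_prod.sum)
  qed
  then show ?case by (auto simp: ideal_power_Suc)
qed (simp add: ideal_power_0)

section \<open>Monomial ideals\<close>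

abbreviation monomial :: "('v \<Rightarrow>\<^sub>0 nat) \<Rightarrow> ('v, 'k::field) mpoly"
  where "monomial a \<equiv> Poly_Mapping.single a 1"

lemma keys_mult_subset:
  assumes "a \<in> Poly_Mapping.keys (f * g)"
  obtains b c where "b \<in> Poly_Mapping.keys f" "c \<in> Poly_Mapping.keys g" "a = b + c"
  using assms keys_mult[of f g] by blast

lemma lookup_single_zero_mult:
  fixes f :: "('v, 'k::field) mpoly"
  shows "Poly_Mapping.lookup (Poly_Mapping.single 0 c * f) a = c * Poly_Mapping.lookup f a"
  by (simp add: mult_map_scale_conv_mult[symmetric] Poly_Mapping.map.rep_eq when_def)

lemma poly_mapping_sum_single:
  fixes f :: "'a \<Rightarrow>\<^sub>0 'b::comm_monoid_add"
  shows "f = (\<Sum>a\<in>Poly_Mapping.keys f. Poly_Mapping.single a (Poly_Mapping.lookup f a))"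
  by (rule poly_mapping_eqI)
    (auto simp: lookup_sum lookup_single when_def in_keys_iff sum.delta)

text \<open>The coefficients are units times monomials, written as products with constants
  \<open>Poly_Mapping.single 0 c\<close>. This reduces membership to single exponents.\<close>

lemma monomials_in_ideal:
  fixes f :: "('v, 'k::field) mpoly"
  assumes "ideal I (mpoly_ring :: ('v, 'k) mpoly ring)" "\<And>a. a \<in> Poly_Mapping.keys f \<Longrightarrow> monomial a \<in> I"
  shows "f \<in> I"
proof -
  have "Poly_Mapping.single a (Poly_Mapping.lookup f a) =
      Poly_Mapping.single 0 (Poly_Mapping.lookup f a) * monomial a" for a
    by (simp add: mult_single)
  then have "Poly_Mapping.single a (Poly_Mapping.lookup f a) \<in> I" if "a \<in> Poly_Mapping.keys f" for a
    using assms that by (auto simp: ideal_iff)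
  then have "(\<Sum>a\<in>Poly_Mapping.keys f. Poly_Mapping.single a (Poly_Mapping.lookup f a)) \<in> I"
    by (intro ideal_sum_closed[OF assms(1)])
  then show ?thesis by (simp flip: poly_mapping_sum_single)
qed

lemma ideal_keys_subset:
  assumes "\<And>a b. a \<in> U \<Longrightarrow> b + a \<in> U"
  shows "ideal {f :: ('v, 'k::field) mpoly. Poly_Mapping.keys f \<subseteq> U} mpoly_ring"
  unfolding ideal_iff
proof (intro conjI ballI allI)
  fix f g :: "('v, 'k) mpoly"
  assume "f \<in> {f. Poly_Mapping.keys f \<subseteq> U}"
  then show "g * f \<in> {f. Poly_Mapping.keys f \<subseteq> U}"
    using assms by (auto elim!: keys_mult_subset)
  assume "g \<in> {f. Poly_Mapping.keys f \<subseteq> U}"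
  with \<open>f \<in> _\<close> show "f + g \<in> {f. Poly_Mapping.keys f \<subseteq> U}"
    using keys_add[of f g] by auto
qed auto

text \<open>Exponents lying above some member of \<open>M\<close> are closed under adding exponents,
  so the right-hand side is an ideal. Membership thus depends on the exponents that occur and not on
  the coefficients.\<close>

lemma Idl_monomials:
  "Idl\<^bsub>mpoly_ring\<^esub> (monomial ` M) =
     {f :: ('v, 'k::field) mpoly. Poly_Mapping.keys f \<subseteq> {b + a | a b. a \<in> M}}"
    (is "_ = ?J")
proof
  interpret R: cring "mpoly_ring :: ('v, 'k) mpoly ring" by rule
  have "ideal ?J mpoly_ring"
  proof (rule ideal_keys_subset)
    fix c d assume "c \<in> {b + a | a b. a \<in> M}"
    then obtain a b where "c = b + a" "a \<in> M" by blast
    then have "d + c = (d + b) + a" by (simp add: add.assoc)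
    with \<open>a \<in> M\<close> show "d + c \<in> {b + a | a b. a \<in> M}" by blast
  qed
  moreover have "monomial ` M \<subseteq> ?J"
    by auto (metis add.left_neutral)
  ultimately show "Idl\<^bsub>mpoly_ring\<^esub> (monomial ` M) \<subseteq> ?J"
    by (rule R.genideal_minimal)
  show "?J \<subseteq> Idl\<^bsub>mpoly_ring\<^esub> (monomial ` M)"
  proof
    fix f assume f: "f \<in> ?J"
    have I: "ideal (Idl\<^bsub>mpoly_ring\<^esub> (monomial ` M :: ('v, 'k) mpoly set)) mpoly_ring"
      by (rule R.genideal_ideal) simp
    show "f \<in> Idl\<^bsub>mpoly_ring\<^esub> (monomial ` M)"
    proof (rule monomials_in_ideal[OF I])
      fix c assume "c \<in> Poly_Mapping.keys f"
      then obtain a b where c: "c = b + a" "a \<in> M" using f by auto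
      have "(monomial c :: ('v, 'k) mpoly) = monomial b * monomial a"
        by (simp add: c mult_single)
      moreover have "(monomial a :: ('v, 'k) mpoly) \<in> Idl\<^bsub>mpoly_ring\<^esub> (monomial ` M)"
        using R.genideal_self[of "monomial ` M"] c by auto
      ultimately show "monomial c \<in> Idl\<^bsub>mpoly_ring\<^esub> (monomial ` M :: ('v, 'k) mpoly set)"
        using I unfolding ideal_iff by auto
    qed
  qed
qed

lemma single_summand_iff: "(\<exists>b. a = b + Poly_Mapping.single v 1) \<longleftrightarrow> Poly_Mapping.lookup a v \<noteq> 0"
  for a :: "'v \<Rightarrow>\<^sub>0 nat"
proof
  assume "Poly_Mapping.lookup a v \<noteq> 0"
  then have "a = (a - Poly_Mapping.single v 1) + Poly_Mapping.single v 1"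
    by (intro poly_mapping_eqI) (auto simp: lookup_add lookup_minus lookup_single when_def)
  then show "\<exists>b. a = b + Poly_Mapping.single v 1" by blast
qed (auto simp: lookup_add)

lemma Idl_Var:
  "Idl\<^bsub>mpoly_ring\<^esub> (Var ` A) =
     {f :: ('v, 'k::field) mpoly. \<forall>a\<in>Poly_Mapping.keys f. \<exists>v\<in>A. Poly_Mapping.lookup a v \<noteq> 0}"
proof -
  have *: "(Var ` A :: ('v, 'k) mpoly set) = monomial ` ((\<lambda>v. Poly_Mapping.single v 1) ` A)"
    by (auto simp: Var_def)
  show ?thesis
    unfolding * Idl_monomials single_summand_iff[symmetric] by blast
qed

lemma ideal_Idl_Var: "ideal (Idl\<^bsub>mpoly_ring\<^esub> (Var ` A :: ('v, 'k::field) mpoly set)) mpoly_ring"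
proof -
  interpret R: cring "mpoly_ring :: ('v, 'k) mpoly ring" by rule
  show ?thesis by (rule R.genideal_ideal) simp
qed

lemma Idl_Var_subset_iff:
  "Idl\<^bsub>mpoly_ring\<^esub> (Var ` A) \<subseteq> (Idl\<^bsub>mpoly_ring\<^esub> (Var ` B) :: ('v, 'k::field) mpoly set) \<longleftrightarrow> A \<subseteq> B"
proof
  assume *: "Idl\<^bsub>mpoly_ring\<^esub> (Var ` A) \<subseteq> (Idl\<^bsub>mpoly_ring\<^esub> (Var ` B) :: ('v, 'k) mpoly set)"
  show "A \<subseteq> B"
  proof
    fix v assume "v \<in> A"
    then have "(Var v :: ('v, 'k) mpoly) \<in> Idl\<^bsub>mpoly_ring\<^esub> (Var ` A)"
      by (auto simp: Idl_Var) (auto simp: Var_def lookup_single when_def)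
    with * have "(Var v :: ('v, 'k) mpoly) \<in> Idl\<^bsub>mpoly_ring\<^esub> (Var ` B)" by blast
    then show "v \<in> B"
      by (auto simp: Idl_Var) (auto simp: Var_def lookup_single when_def split: if_splits)
  qed
qed (auto simp: Idl_Var, blast)

text \<open>The degree in the variables of \<open>A\<close> is additive under products, each factor
  contributes at least 1, and sums create no new exponents.\<close>

lemma ideal_power_Idl_Var:
  fixes f :: "('v::finite, 'k::field) mpoly"
  assumes "f \<in> ideal_power mpoly_ring (Idl\<^bsub>mpoly_ring\<^esub> (Var ` A)) k" "a \<in> Poly_Mapping.keys f"
  shows "k \<le> (\<Sum>v\<in>A. Poly_Mapping.lookup a v)"
  using assms
proof (induction k arbitrary: f a)
  case (Suc k)
  from Suc.prems(1) have "f \<in> ideal_prod mpoly_ring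
      (ideal_power mpoly_ring (Idl\<^bsub>mpoly_ring\<^esub> (Var ` A)) k) (Idl\<^bsub>mpoly_ring\<^esub> (Var ` A))"
    by (simp add: ideal_power_Suc)
  then show ?case using Suc.prems(2)
  proof (induction arbitrary: a)
    case (prod i j)
    then obtain b c where bc: "b \<in> Poly_Mapping.keys i" "c \<in> Poly_Mapping.keys j" "a = b + c"
      by (auto elim: keys_mult_subset)
    from prod bc obtain v where v: "v \<in> A" "Poly_Mapping.lookup c v \<noteq> 0"
      by (auto simp: Idl_Var)
    then have "Poly_Mapping.lookup c v \<le> (\<Sum>v\<in>A. Poly_Mapping.lookup c v)"
      by (intro member_le_sum) auto
    with v have "1 \<le> (\<Sum>v\<in>A. Poly_Mapping.lookup c v)" by linarith
    moreover have "k \<le> (\<Sum>v\<in>A. Poly_Mapping.lookup b v)" using Suc.IH prod bc by blast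
    ultimately show ?case by (simp add: bc lookup_add sum.distrib)
  next
    case (sum s1 s2)
    then show ?case using keys_add[of s1 s2] by auto
  qed
qed simp

section \<open>Primality of ideals generated by variables\<close>

text \<open>Lexicographically largest elements of \<open>F\<close> and \<open>G\<close> have a sum
  with no other representation. They are found by maximising one coordinate after another. This
  yields a term of a product that cannot cancel.\<close>

lemma unique_sum_of_exponents:
  fixes F G :: "('v::finite \<Rightarrow>\<^sub>0 nat) set"
  assumes "finite F" "finite G" "F \<noteq> {}" "G \<noteq> {}"
  obtains a b where "a \<in> F" "b \<in> G"
    "\<And>a' b'. a' \<in> F \<Longrightarrow> b' \<in> G \<Longrightarrow> a' + b' = a + b \<Longrightarrow> a' = a \<and> b' = b"
proof -
  define agree :: "'v set \<Rightarrow> ('v \<Rightarrow>\<^sub>0 nat) set \<Rightarrow> bool" where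
    "agree V H \<longleftrightarrow> (\<forall>a\<in>H. \<forall>a'\<in>H. \<forall>v\<in>V. Poly_Mapping.lookup a v = Poly_Mapping.lookup a' v)" for V H
  \<comment> \<open>This property survives maximising a coordinate in both sets: a sum
    \<open>p + q\<close> of two maxima can only come from two elements attaining them.\<close>
  define extremal where
    "extremal F' G' \<longleftrightarrow> (\<forall>a\<in>F'. \<forall>b\<in>G'. \<forall>a'\<in>F. \<forall>b'\<in>G. a' + b' = a + b \<longrightarrow> a' \<in> F' \<and> b' \<in> G')" for F' G'
  have "\<exists>F' G'. F' \<subseteq> F \<and> G' \<subseteq> G \<and> F' \<noteq> {} \<and> G' \<noteq> {} \<and> agree V F' \<and> agree V G' \<and> extremal F' G'"
    if "finite V" for V
    using that
  proof induction
    case empty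
    then show ?case using assms
      by (intro exI[of _ F] exI[of _ G]) (auto simp: agree_def extremal_def)
  next
    case (insert v V)
    then obtain F' G' where FG: "F' \<subseteq> F" "G' \<subseteq> G" "F' \<noteq> {}" "G' \<noteq> {}"
      "agree V F'" "agree V G'" and ext: "extremal F' G'"
      by blast
    have fin: "finite F'" "finite G'" using FG assms finite_subset by auto
    define p q where "p = Max ((\<lambda>a. Poly_Mapping.lookup a v) ` F')"
      and "q = Max ((\<lambda>a. Poly_Mapping.lookup a v) ` G')"
    define F1 G1 where "F1 = {a\<in>F'. Poly_Mapping.lookup a v = p}"
      and "G1 = {b\<in>G'. Poly_Mapping.lookup b v = q}"
    have p: "Poly_Mapping.lookup a v \<le> p" if "a \<in> F'" for a
      using fin that unfolding p_def by (intro Max_ge) auto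
    have q: "Poly_Mapping.lookup a v \<le> q" if "a \<in> G'" for a
      using fin that unfolding q_def by (intro Max_ge) auto
    have "p \<in> (\<lambda>a. Poly_Mapping.lookup a v) ` F'" "q \<in> (\<lambda>a. Poly_Mapping.lookup a v) ` G'"
      unfolding p_def q_def using fin FG by (auto intro!: Max_in)
    then have "F1 \<noteq> {}" "G1 \<noteq> {}" by (auto simp: F1_def G1_def)
    moreover have "agree (insert v V) F1" "agree (insert v V) G1"
      using FG by (auto simp: agree_def F1_def G1_def)
    moreover have "extremal F1 G1"
      unfolding extremal_def
    proof (intro ballI impI)
      fix a b a' b' assume *: "a \<in> F1" "b \<in> G1" "a' \<in> F" "b' \<in> G" "a' + b' = a + b"
      then have "a' \<in> F'" "b' \<in> G'" using ext by (auto simp: extremal_def F1_def G1_def)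
      moreover have "Poly_Mapping.lookup a' v + Poly_Mapping.lookup b' v =
          Poly_Mapping.lookup a v + Poly_Mapping.lookup b v"
        by (simp only: lookup_add[symmetric] *)
      then have "Poly_Mapping.lookup a' v + Poly_Mapping.lookup b' v = p + q"
        using * by (simp add: F1_def G1_def)
      ultimately show "a' \<in> F1 \<and> b' \<in> G1" using p[of a'] q[of b'] by (auto simp: F1_def G1_def)
    qed
    moreover have "F1 \<subseteq> F" "G1 \<subseteq> G" using FG by (auto simp: F1_def G1_def)
    ultimately show ?case by blast
  qed
  from this[OF finite[of UNIV]] obtain F' G' where FG: "F' \<subseteq> F" "G' \<subseteq> G" "F' \<noteq> {}" "G' \<noteq> {}"
     "agree UNIV F'" "agree UNIV G'" and ext: "extremal F' G'"
    by blast
  then obtain a b where ab: "a \<in> F'" "b \<in> G'" by blast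
  show ?thesis
  proof (rule that[of a b])
    fix a' b' assume "a' \<in> F" "b' \<in> G" "a' + b' = a + b"
    then have "a' \<in> F'" "b' \<in> G'" using ext ab unfolding extremal_def by blast+
    then show "a' = a \<and> b' = b" using FG ab unfolding agree_def by (blast intro!: poly_mapping_eqI)
  qed (use ab FG in auto)
qed

text \<open>At most one term of the convolution contributes. If \<open>a\<close> or \<open>b\<close>
  is not a key, both sides vanish.\<close>

lemma lookup_mult_unique_sum:
  fixes f g :: "('v, 'k::field) mpoly"
  assumes "\<And>a' b'. a' \<in> Poly_Mapping.keys f \<Longrightarrow> b' \<in> Poly_Mapping.keys g \<Longrightarrow> a' + b' = a + b \<Longrightarrow> a' = a \<and> b' = b"
  shows "Poly_Mapping.lookup (f * g) (a + b) = Poly_Mapping.lookup f a * Poly_Mapping.lookup g b"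
proof -
  have "f * g = (\<Sum>c\<in>Poly_Mapping.keys f. \<Sum>d\<in>Poly_Mapping.keys g.
      Poly_Mapping.single (c + d) (Poly_Mapping.lookup f c * Poly_Mapping.lookup g d))"
    by (subst (1) poly_mapping_sum_single[of f], subst (1) poly_mapping_sum_single[of g])
      (simp add: sum_product mult_single)
  then have "Poly_Mapping.lookup (f * g) (a + b) = (\<Sum>c\<in>Poly_Mapping.keys f. \<Sum>d\<in>Poly_Mapping.keys g.
      Poly_Mapping.lookup f c * Poly_Mapping.lookup g d when c + d = a + b)"
    by (simp add: lookup_sum lookup_single)
  also have "\<dots> = (\<Sum>c\<in>Poly_Mapping.keys f. \<Sum>d\<in>Poly_Mapping.keys g.
      if c = a then if d = b then Poly_Mapping.lookup f a * Poly_Mapping.lookup g b else 0 else 0)"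
    using assms by (intro sum.cong) (auto simp: when_def)
  also have "\<dots> = Poly_Mapping.lookup f a * Poly_Mapping.lookup g b"
  proof -
    have "(\<Sum>d\<in>Poly_Mapping.keys g. if c = a then
          if d = b then Poly_Mapping.lookup f a * Poly_Mapping.lookup g b else 0 else 0) =
        (if c = a then Poly_Mapping.lookup f a * Poly_Mapping.lookup g b else 0)" for c
      by (auto simp: sum.delta in_keys_iff)
    then show ?thesis by (auto simp: sum.delta in_keys_iff)
  qed
  finally show ?thesis .
qed

lemma primeideal_Idl_Var:
  "primeideal (Idl\<^bsub>mpoly_ring\<^esub> (Var ` A :: ('v::finite, 'k::field) mpoly set)) mpoly_ring"
  unfolding primeideal_iff
proof (intro conjI allI impI ideal_Idl_Var)
  show "1 \<notin> Idl\<^bsub>mpoly_ring\<^esub> (Var ` A :: ('v, 'k) mpoly set)" by (auto simp: Idl_Var)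
  fix f g :: "('v, 'k) mpoly"
  assume fg: "f * g \<in> Idl\<^bsub>mpoly_ring\<^esub> (Var ` A)"
  show "f \<in> Idl\<^bsub>mpoly_ring\<^esub> (Var ` A) \<or> g \<in> Idl\<^bsub>mpoly_ring\<^esub> (Var ` A)"
  proof (rule ccontr)
    assume n: "\<not> ?thesis"
    \<comment> \<open>\<open>U\<close> holds the exponents that survive setting the variables of
      \<open>A\<close> to 0. Outside the ideal, \<open>f\<close> and \<open>g\<close> both have such
      exponents, and a non-cancelling sum of two of them survives in \<open>f * g\<close>.\<close>
    define U where "U = {a :: 'v \<Rightarrow>\<^sub>0 nat. \<forall>v\<in>A. Poly_Mapping.lookup a v = 0}"
    have U: "a + b \<in> U \<longleftrightarrow> a \<in> U \<and> b \<in> U" for a b by (auto simp: U_def lookup_add)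
    obtain a b where ab: "a \<in> Poly_Mapping.keys f \<inter> U" "b \<in> Poly_Mapping.keys g \<inter> U"
      "\<And>a' b'. a' \<in> Poly_Mapping.keys f \<inter> U \<Longrightarrow> b' \<in> Poly_Mapping.keys g \<inter> U \<Longrightarrow>
         a' + b' = a + b \<Longrightarrow> a' = a \<and> b' = b"
    proof (rule unique_sum_of_exponents[of "Poly_Mapping.keys f \<inter> U" "Poly_Mapping.keys g \<inter> U"])
      show "Poly_Mapping.keys f \<inter> U \<noteq> {}" "Poly_Mapping.keys g \<inter> U \<noteq> {}"
        using n by (auto simp: Idl_Var U_def)
    qed auto
    have "Poly_Mapping.lookup (f * g) (a + b) = Poly_Mapping.lookup f a * Poly_Mapping.lookup g b"
    proof (rule lookup_mult_unique_sum)
      fix a' b' assume *: "a' \<in> Poly_Mapping.keys f" "b' \<in> Poly_Mapping.keys g" "a' + b' = a + b"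
      from ab have "a + b \<in> U" by (simp add: U)
      with * have "a' \<in> U" "b' \<in> U" by (metis U)+
      with * ab show "a' = a \<and> b' = b" by blast
    qed
    with ab have "a + b \<in> Poly_Mapping.keys (f * g)" by (auto simp: in_keys_iff)
    with fg have "a + b \<notin> U" by (auto simp: Idl_Var U_def)
    with ab show False by (simp add: U)
  qed
qed

section \<open>Algebraic dependence and heights\<close>

text \<open>Gaussian elimination: row \<open>i\<close> is solved for an unknown \<open>l\<close>
  with nonzero coefficient, and \<open>l\<close> is eliminated from the other rows.\<close>

lemma homogeneous_system:
  fixes A :: "'i \<Rightarrow> 'j \<Rightarrow> 'k::field"
  assumes "finite I" "finite J" "card I < card J"
  obtains c where "\<exists>j\<in>J. c j \<noteq> 0" "\<And>i. i \<in> I \<Longrightarrow> (\<Sum>j\<in>J. A i j * c j) = 0"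
proof -
  have "\<exists>c. (\<exists>j\<in>J. c j \<noteq> 0) \<and> (\<forall>i\<in>I. (\<Sum>j\<in>J. A i j * c j) = 0)"
    using assms
  proof (induction I arbitrary: J A rule: finite_induct)
    case empty
    then obtain j where "j \<in> J" by fastforce
    then show ?case by (intro exI[of _ "\<lambda>_. 1"]) auto
  next
    case (insert i I)
    show ?case
    proof (cases "\<forall>j\<in>J. A i j = 0")
      case True
      with insert.IH[of J A] insert.prems insert.hyps show ?thesis by auto
    next
      case False
      then obtain l where l: "l \<in> J" "A i l \<noteq> 0" by blast
      have "card I < card (J - {l})" using insert l by simp
      with insert.IH[of "J - {l}" "\<lambda>r j. A r j - A r l * A i j / A i l"] insert.prems
      obtain c where c: "\<exists>j\<in>J-{l}. c j \<noteq> 0"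
        "\<And>r. r \<in> I \<Longrightarrow> (\<Sum>j\<in>J-{l}. (A r j - A r l * A i j / A i l) * c j) = 0"
        by auto
      \<comment> \<open>The value at \<open>l\<close> is the one forced by row
        \<open>i\<close>.\<close>
      define d where "d = c(l := - (\<Sum>j\<in>J-{l}. A i j * c j) / A i l)"
      have split: "(\<Sum>j\<in>J. A r j * d j) = A r l * d l + (\<Sum>j\<in>J-{l}. A r j * c j)" for r
        using insert.prems l by (subst sum.remove[of _ l]) (auto simp: d_def intro!: sum.cong)
      have "(\<Sum>j\<in>J. A r j * d j) = 0" if "r \<in> I" for r
      proof -
        have "0 = (\<Sum>j\<in>J-{l}. A r j * c j) - A r l / A i l * (\<Sum>j\<in>J-{l}. A i j * c j)"
          unfolding c(2)[OF that, symmetric] sum_subtractf[symmetric] sum_distrib_left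
          by (intro sum.cong) (auto simp: algebra_simps)
        then show ?thesis
          unfolding split by (simp add: d_def)
      qed
      moreover have "(\<Sum>j\<in>J. A i j * d j) = 0"
        unfolding split using l by (simp add: d_def)
      moreover have "\<exists>j\<in>J. d j \<noteq> 0" using c(1) by (auto simp: d_def)
      ultimately show ?thesis by auto
    qed
  qed
  with that show ?thesis by blast
qed

lemma lookup_mult_le:
  fixes f g :: "('v, 'k::field) mpoly"
  assumes "\<And>a. a \<in> Poly_Mapping.keys f \<Longrightarrow> Poly_Mapping.lookup a v \<le> p"
    and "\<And>a. a \<in> Poly_Mapping.keys g \<Longrightarrow> Poly_Mapping.lookup a v \<le> q"
    and "a \<in> Poly_Mapping.keys (f * g)"
  shows "Poly_Mapping.lookup a v \<le> p + q"
  using assms(3) by (rule keys_mult_subset) (auto simp: lookup_add intro!: add_mono assms)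

lemma lookup_power_le:
  fixes f :: "('v, 'k::field) mpoly"
  assumes "\<And>a. a \<in> Poly_Mapping.keys f \<Longrightarrow> Poly_Mapping.lookup a v \<le> p"
    and "a \<in> Poly_Mapping.keys (f ^ e)"
  shows "Poly_Mapping.lookup a v \<le> e * p"
  using assms(2)
proof (induction e arbitrary: a)
  case (Suc e)
  then show ?case using lookup_mult_le[of f v p "f ^ e" "e * p" a] assms(1) by auto
qed auto

lemma lookup_prod_le:
  fixes f :: "'i \<Rightarrow> ('v, 'k::field) mpoly"
  assumes "\<And>i a. i \<in> L \<Longrightarrow> a \<in> Poly_Mapping.keys (f i) \<Longrightarrow> Poly_Mapping.lookup a v \<le> p"
    and "finite L" and "a \<in> Poly_Mapping.keys (prod f L)"
  shows "Poly_Mapping.lookup a v \<le> card L * p"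
  using assms(2,1,3)
proof (induction L arbitrary: a)
  case (insert i L)
  then show ?case using lookup_mult_le[of "f i" v p "prod f L" "card L * p" a] by auto
qed auto

lemma card_bounded_exponents:
  "finite {a :: 'v::finite \<Rightarrow>\<^sub>0 nat. \<forall>v. Poly_Mapping.lookup a v \<le> M}"
  "card {a :: 'v \<Rightarrow>\<^sub>0 nat. \<forall>v. Poly_Mapping.lookup a v \<le> M} \<le> (M + 1) ^ CARD('v)"
proof -
  let ?B = "PiE UNIV (\<lambda>_ :: 'v. {..M})"
  have inj: "inj_on Poly_Mapping.lookup {a :: 'v \<Rightarrow>\<^sub>0 nat. \<forall>v. Poly_Mapping.lookup a v \<le> M}"
    by (auto intro!: inj_onI poly_mapping_eqI)
  have sub: "Poly_Mapping.lookup ` {a :: 'v \<Rightarrow>\<^sub>0 nat. \<forall>v. Poly_Mapping.lookup a v \<le> M} \<subseteq> ?B"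
    by auto
  have fin: "finite ?B" by (intro finite_PiE) auto
  show "finite {a :: 'v \<Rightarrow>\<^sub>0 nat. \<forall>v. Poly_Mapping.lookup a v \<le> M}"
    by (rule inj_on_finite[OF inj sub fin])
  have "card ?B = (M + 1) ^ CARD('v)" by (simp add: card_PiE)
  then show "card {a :: 'v \<Rightarrow>\<^sub>0 nat. \<forall>v. Poly_Mapping.lookup a v \<le> M} \<le> (M + 1) ^ CARD('v)"
    using card_inj_on_le[OF inj sub fin] by simp
qed

text \<open>There are \<open>(t + 1) ^ (N + 1)\<close> products of powers with exponents at most \<open>t\<close>, but only
  \<open>O(t ^ N)\<close> monomials can occur in them.\<close>

lemma algebraic_dependence:
  fixes y :: "nat \<Rightarrow> ('v::finite, 'k::field) mpoly"
  obtains J and c :: "(nat \<Rightarrow> nat) \<Rightarrow> 'k" where "finite J" "J \<noteq> {}"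
    "\<And>e. e \<in> J \<Longrightarrow> e \<in> extensional {..CARD('v)}" "\<And>e. e \<in> J \<Longrightarrow> c e \<noteq> 0"
    "(\<Sum>e\<in>J. Poly_Mapping.single 0 (c e) * (\<Prod>i\<le>CARD('v). y i ^ e i)) = 0"
proof -
  define N where "N = CARD('v)"
  define d where "d = Max ((\<lambda>(a, v). Poly_Mapping.lookup a v) ` ((\<Union>i\<le>N. Poly_Mapping.keys (y i)) \<times> UNIV))"
  have d: "Poly_Mapping.lookup a v \<le> d" if "i \<le> N" "a \<in> Poly_Mapping.keys (y i)" for i a v
    unfolding d_def using that by (intro Max_ge) (auto intro!: image_eqI[of _ _ "(a, v)"])
  \<comment> \<open>With this value the bound on \<open>card B\<close> becomes
    \<open>t * (t + 1) ^ N\<close>, which is below \<open>(t + 1) ^ Suc N\<close>, the number of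
    tuples in \<open>J\<close>.\<close>
  define t where "t = (Suc N * d + 1) ^ N"
  \<comment> \<open>Extensional tuples are equal once they agree up to \<open>N\<close>;
    \<open>prime_chain_length\<close> relies on this.\<close>
  define J where "J = PiE {..N} (\<lambda>_. {..t})"
  have J_extensional: "e \<in> extensional {..N}" if "e \<in> J" for e
    using that by (simp add: J_def PiE_iff)
  define M where "M = Suc N * (t * d)"
  define B where "B = {a :: 'v \<Rightarrow>\<^sub>0 nat. \<forall>v. Poly_Mapping.lookup a v \<le> M}"
  define z where "z e = (\<Prod>i\<le>N. y i ^ e i)" for e
  have "finite J" unfolding J_def by (intro finite_PiE) auto
  have "finite B" unfolding B_def by (rule card_bounded_exponents)
  have "card B \<le> (M + 1) ^ N" unfolding B_def N_def by (rule card_bounded_exponents)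
  also have "\<dots> \<le> ((Suc N * d + 1) * (t + 1)) ^ N"
    by (intro power_mono) (auto simp: M_def algebra_simps)
  also have "\<dots> = t * (t + 1) ^ N" by (simp only: power_mult_distrib t_def[symmetric])
  also have "\<dots> < (t + 1) ^ Suc N" by simp
  also have "\<dots> = card J" by (simp add: J_def card_PiE)
  finally have "card B < card J" .
  with homogeneous_system[of B J "\<lambda>a e. Poly_Mapping.lookup (z e) a"] \<open>finite J\<close> \<open>finite B\<close>
  obtain c where c: "\<exists>e\<in>J. c e \<noteq> 0" "\<And>a. a \<in> B \<Longrightarrow> (\<Sum>e\<in>J. Poly_Mapping.lookup (z e) a * c e) = 0"
    by metis
  have outside: "Poly_Mapping.lookup (z e) a = 0" if "e \<in> J" "a \<notin> B" for e a
  proof (rule ccontr)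
    assume "Poly_Mapping.lookup (z e) a \<noteq> 0"
    then have a: "a \<in> Poly_Mapping.keys (z e)" by (simp add: in_keys_iff)
    have "Poly_Mapping.lookup a v \<le> card {..N} * (t * d)" for v
    proof (rule lookup_prod_le[OF _ _ a[unfolded z_def]])
      fix i b assume i: "i \<in> {..N}" and b: "b \<in> Poly_Mapping.keys (y i ^ e i)"
      have "Poly_Mapping.lookup b v \<le> e i * d"
        by (rule lookup_power_le[OF _ b]) (use d i in auto)
      also have "\<dots> \<le> t * d" using that i by (intro mult_right_mono) (auto simp: J_def PiE_iff)
      finally show "Poly_Mapping.lookup b v \<le> t * d" .
    qed auto
    with \<open>a \<notin> B\<close> show False by (simp add: B_def M_def)
  qed
  have "(\<Sum>e\<in>J. c e * Poly_Mapping.lookup (z e) a) = 0" for a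
    using c(2) outside by (cases "a \<in> B") (auto simp: mult.commute)
  then have "(\<Sum>e\<in>J. Poly_Mapping.single 0 (c e) * z e) = 0"
    by (intro poly_mapping_eqI) (simp add: lookup_sum lookup_single_zero_mult)
  \<comment> \<open>Terms with coefficient 0 are discarded, so that every remaining coefficient is a
    unit.\<close>
  moreover have "(\<Sum>e\<in>J. Poly_Mapping.single 0 (c e) * z e) =
      (\<Sum>e\<in>{e\<in>J. c e \<noteq> 0}. Poly_Mapping.single 0 (c e) * z e)"
    using \<open>finite J\<close> by (intro sum.mono_neutral_right) auto
  moreover have "finite {e\<in>J. c e \<noteq> 0}" using \<open>finite J\<close> by simp
  ultimately show ?thesis
    using c(1) by (intro that[of "{e\<in>J. c e \<noteq> 0}" c]) (auto simp flip: z_def N_def simp: J_extensional)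
qed

text \<open>Given a polynomial relation between elements \<open>y i\<close> of \<open>P (i + 1)\<close> outside \<open>P i\<close>, its terms
  of lexicographically least exponent cannot cancel: successively, the least power of \<open>y i\<close> is
  divided out modulo \<open>P i\<close> and the remaining multiples of \<open>y i\<close> are discarded modulo
  \<open>P (i + 1)\<close>.\<close>

lemma prime_chain_length:
  fixes P :: "nat \<Rightarrow> ('v::finite, 'k::field) mpoly set"
  assumes prime: "\<And>i. i \<le> n \<Longrightarrow> primeideal (P i) mpoly_ring" and chain: "\<And>i. i < n \<Longrightarrow> P i \<subset> P (Suc i)"
  shows "n \<le> CARD('v)"
proof (rule ccontr)
  define N where "N = CARD('v)"
  assume "\<not> n \<le> CARD('v)"
  then have n: "Suc N \<le> n" by (simp add: N_def)
  then have "\<exists>y. y \<in> P (Suc i) - P i" if "i \<le> N" for i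
    using chain[of i] that by auto
  then obtain y where y: "\<And>i. i \<le> N \<Longrightarrow> y i \<in> P (Suc i)" "\<And>i. i \<le> N \<Longrightarrow> y i \<notin> P i"
    by (metis DiffE)
  obtain J and c :: "(nat \<Rightarrow> nat) \<Rightarrow> 'k" where J: "finite J" "J \<noteq> {}"
    "\<And>e. e \<in> J \<Longrightarrow> e \<in> extensional {..N}" "\<And>e. e \<in> J \<Longrightarrow> c e \<noteq> 0"
    "(\<Sum>e\<in>J. Poly_Mapping.single 0 (c e) * (\<Prod>i\<le>N. y i ^ e i)) = 0"
    using algebraic_dependence[of y] unfolding N_def by blast
  \<comment> \<open>Omitting the factors below \<open>i\<close> loses nothing: the retained
    exponents agree there, and the common powers have been divided out.\<close>
  define z :: "nat \<Rightarrow> (nat \<Rightarrow> nat) \<Rightarrow> ('v, 'k) mpoly"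
    where "z i e = Poly_Mapping.single 0 (c e) * (\<Prod>l\<in>{i..N}. y l ^ e l)" for i e
  have "\<exists>J'. J' \<subseteq> J \<and> J' \<noteq> {} \<and> (\<forall>e\<in>J'. \<forall>e'\<in>J'. \<forall>l<i. e l = e' l) \<and> sum (z i) J' \<in> P i"
    if "i \<le> Suc N" for i
    using that
  proof (induction i)
    case 0
    have "sum (z 0) J = 0" using J(5) by (simp add: z_def atLeast0AtMost)
    moreover have "0 \<in> P 0" using prime[of 0] by (simp add: primeideal_iff ideal_iff)
    ultimately show ?case using J by (intro exI[of _ J]) auto
  next
    case (Suc i)
    then obtain J' where J': "J' \<subseteq> J" "J' \<noteq> {}" "\<forall>e\<in>J'. \<forall>e'\<in>J'. \<forall>l<i. e l = e' l" "sum (z i) J' \<in> P i"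
      by auto
    have fin: "finite J'" using J' J finite_subset by blast
    define \<mu> where "\<mu> = Min ((\<lambda>e. e i) ` J')"
    have \<mu>: "\<mu> \<le> e i" if "e \<in> J'" for e unfolding \<mu>_def using fin that by auto
    have "\<mu> \<in> (\<lambda>e. e i) ` J'" unfolding \<mu>_def using fin J' by (intro Min_in) auto
    then have ne: "{e\<in>J'. e i = \<mu>} \<noteq> {}" by auto
    have Pi: "primeideal (P i) mpoly_ring" "primeideal (P (Suc i)) mpoly_ring" "P i \<subseteq> P (Suc i)"
      using prime[of i] prime[of "Suc i"] chain[of i] Suc.prems n by auto
    have zi: "z i e = y i ^ \<mu> * (y i ^ (e i - \<mu>) * z (Suc i) e)" if "e \<in> J'" for e
    proof -
      have "{i..N} = insert i {Suc i..N}" using Suc.prems by auto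
      then have "z i e = y i ^ e i * z (Suc i) e" by (simp add: z_def ac_simps)
      moreover have "y i ^ e i = y i ^ \<mu> * y i ^ (e i - \<mu>)" using \<mu>[OF that] by (simp flip: power_add)
      ultimately show ?thesis by (simp add: mult.assoc)
    qed
    have "sum (z i) J' = y i ^ \<mu> * (\<Sum>e\<in>J'. y i ^ (e i - \<mu>) * z (Suc i) e)"
      unfolding sum_distrib_left by (intro sum.cong refl zi)
    moreover have "y i ^ \<mu> \<notin> P i" for \<mu>
      using Pi(1) y(2)[of i] Suc.prems by (induction \<mu>) (auto simp: primeideal_iff)
    ultimately have total: "(\<Sum>e\<in>J'. y i ^ (e i - \<mu>) * z (Suc i) e) \<in> P (Suc i)"
      using J'(4) Pi(1,3) unfolding primeideal_iff by auto
    have split: "(\<Sum>e\<in>J'. y i ^ (e i - \<mu>) * z (Suc i) e) =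
        (\<Sum>e\<in>{e\<in>J'. e i = \<mu>}. z (Suc i) e) + (\<Sum>e\<in>{e\<in>J'. e i \<noteq> \<mu>}. y i ^ (e i - \<mu>) * z (Suc i) e)"
    proof -
      have "J' = {e\<in>J'. e i = \<mu>} \<union> {e\<in>J'. e i \<noteq> \<mu>}" by auto
      then have "(\<Sum>e\<in>J'. y i ^ (e i - \<mu>) * z (Suc i) e) =
          (\<Sum>e\<in>{e\<in>J'. e i = \<mu>} \<union> {e\<in>J'. e i \<noteq> \<mu>}. y i ^ (e i - \<mu>) * z (Suc i) e)"
        by (rule arg_cong)
      also have "\<dots> = (\<Sum>e\<in>{e\<in>J'. e i = \<mu>}. y i ^ (e i - \<mu>) * z (Suc i) e) +
          (\<Sum>e\<in>{e\<in>J'. e i \<noteq> \<mu>}. y i ^ (e i - \<mu>) * z (Suc i) e)"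
        using fin by (intro sum.union_disjoint) auto
      finally show ?thesis by simp
    qed
    have rest: "(\<Sum>e\<in>{e\<in>J'. e i \<noteq> \<mu>}. y i ^ (e i - \<mu>) * z (Suc i) e) \<in> P (Suc i)"
    proof (rule ideal_sum_closed)
      show ideal: "ideal (P (Suc i)) mpoly_ring" using Pi by (simp add: primeideal_iff)
      fix e assume e: "e \<in> {e\<in>J'. e i \<noteq> \<mu>}"
      then have "e i - \<mu> \<noteq> 0" using \<mu>[of e] by auto
      then obtain r where "e i - \<mu> = Suc r" by (cases "e i - \<mu>") auto
      then have "y i ^ (e i - \<mu>) * z (Suc i) e = (y i ^ r * z (Suc i) e) * y i"
        by (simp add: ac_simps)
      then show "y i ^ (e i - \<mu>) * z (Suc i) e \<in> P (Suc i)"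
        using ideal y(1)[of i] Suc.prems by (simp add: ideal_iff)
    qed
    have cancel: "p \<in> P (Suc i)" if "p + q \<in> P (Suc i)" "q \<in> P (Suc i)" for p q
    proof -
      have "(p + q) + (- 1) * q \<in> P (Suc i)"
        using that Pi(2) unfolding primeideal_iff ideal_iff by blast
      then show ?thesis by simp
    qed
    have "sum (z (Suc i)) {e\<in>J'. e i = \<mu>} \<in> P (Suc i)"
      by (rule cancel[OF total[unfolded split] rest])
    moreover have "\<forall>e\<in>{e\<in>J'. e i = \<mu>}. \<forall>e'\<in>{e\<in>J'. e i = \<mu>}. \<forall>l<Suc i. e l = e' l"
      using J'(3) by (auto simp: less_Suc_eq)
    moreover have "{e\<in>J'. e i = \<mu>} \<subseteq> J" using J'(1) by blast
    ultimately show ?case using ne by blast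
  qed
  from this[OF order_refl] obtain J' where J': "J' \<subseteq> J" "J' \<noteq> {}"
    "\<forall>e\<in>J'. \<forall>e'\<in>J'. \<forall>l<Suc N. e l = e' l" "sum (z (Suc N)) J' \<in> P (Suc N)"
    by blast
  then obtain e where e: "e \<in> J'" by blast
  have "e' = e" if "e' \<in> J'" for e'
  proof
    have ext: "e \<in> extensional {..N}" "e' \<in> extensional {..N}"
      using J' J(3) e that by blast+
    fix l show "e' l = e l"
    proof (cases "l \<le> N")
      case True
      then have "l < Suc N" by simp
      with J'(3) e that show ?thesis by blast
    next
      case False
      with ext show ?thesis by (simp add: extensional_def)
    qed
  qed
  with e have "J' = {e}" by blast
  \<comment> \<open>The product over \<open>{Suc N..N}\<close> is empty, so what remains is a
    nonzero constant, a unit in a prime ideal.\<close>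
  with J' have "Poly_Mapping.single 0 (c e) \<in> P (Suc N)" by (simp add: z_def)
  moreover have "Poly_Mapping.single 0 (inverse (c e)) * Poly_Mapping.single 0 (c e) = (1 :: ('v, 'k) mpoly)"
    using J(4)[of e] e J' by (auto simp: mult_single)
  ultimately have "1 \<in> P (Suc N)"
    using prime[OF n] unfolding primeideal_iff ideal_iff by metis
  then show False using prime[OF n] by (simp add: primeideal_iff)
qed

text \<open>Adding the variables of \<open>A\<close> one by one to the zero ideal gives a chain of
  length \<open>card A\<close>. Conversely, any chain ending at this prime can be prolonged by the
  variables outside \<open>A\<close>, and \<open>prime_chain_length\<close> bounds the result by the
  number of all variables.\<close>

lemma height_Idl_Var:
  "height mpoly_ring (Idl\<^bsub>mpoly_ring\<^esub> (Var ` A) :: ('v::finite, 'k::field) mpoly set) = enat (card A)"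
proof -
  define chain_to :: "nat \<Rightarrow> ('v, 'k) mpoly set \<Rightarrow> bool" where
    "chain_to n Q \<longleftrightarrow> (\<exists>C. (\<forall>i\<le>n. primeideal (C i) mpoly_ring) \<and> (\<forall>i<n. C i \<subset> C (Suc i)) \<and> C n = Q)" for n Q
  let ?P = "\<lambda>A. Idl\<^bsub>mpoly_ring\<^esub> (Var ` A) :: ('v, 'k) mpoly set"
  have bound: "n \<le> CARD('v)" if "chain_to n Q" for n Q
    using that prime_chain_length unfolding chain_to_def by blast
  have extend: "chain_to (Suc n) Q'" if "chain_to n Q" "Q \<subset> Q'" "primeideal Q' mpoly_ring" for n Q Q'
  proof -
    from that(1) obtain C where C: "\<forall>i\<le>n. primeideal (C i) mpoly_ring" "\<forall>i<n. C i \<subset> C (Suc i)" "C n = Q"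
      unfolding chain_to_def by blast
    show ?thesis
      unfolding chain_to_def
      by (rule exI[of _ "C(Suc n := Q')"]) (use C that in \<open>auto simp: le_Suc_eq less_Suc_eq\<close>)
  qed
  have add_vars: "chain_to (n + card B) (?P (A \<union> B))" if "chain_to n (?P A)" "A \<inter> B = {}" for n A B
    using finite[of B] that
  proof (induction B)
    case (insert v B)
    have "?P (A \<union> B) \<subset> ?P (A \<union> insert v B)"
      using insert unfolding less_le_not_le Idl_Var_subset_iff by auto
    then show ?case
      using extend[OF _ _ primeideal_Idl_Var[of "A \<union> insert v B"], of "n + card B" "?P (A \<union> B)"] insert
      by simp
  qed auto
  have "chain_to 0 (?P {})"
    unfolding chain_to_def using primeideal_Idl_Var[of "{}"] by auto
  from add_vars[OF this, of A] have "chain_to (card A) (?P A)" by simp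
  moreover have "n \<le> card A" if "chain_to n (?P A)" for n
  proof -
    have "n + card (- A) \<le> CARD('v)" using add_vars[OF that, of "- A"] bound by auto
    moreover have "card A + card (- A) = CARD('v)"
      using card_Un_disjoint[of A "- A"] by (simp add: Compl_partition)
    ultimately show ?thesis by simp
  qed
  ultimately show ?thesis
    unfolding height_def chain_to_def[symmetric]
    by (intro antisym Sup_least Sup_upper) auto
qed

section \<open>Irredundant decompositions\<close>

text \<open>If \<open>Q\<close> is not inside \<open>P\<close>, an \<open>x\<close> in
  \<open>Q\<close> outside \<open>P\<close> multiplies every element of the remaining intersection
  into \<open>P\<close>, so that intersection already lies in \<open>P\<close>. The empty
  intersection is the whole ring, which no prime contains.\<close>

lemma primeideal_contains_Inter:
  assumes "finite \<Q>" "\<And>Q. Q \<in> \<Q> \<Longrightarrow> ideal Q (ring_of_type_algebra :: 'r::comm_ring_1 ring)"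
    and P: "primeideal P (ring_of_type_algebra :: 'r ring)" and "\<Inter>\<Q> \<subseteq> P"
  obtains Q where "Q \<in> \<Q>" "Q \<subseteq> P"
proof -
  have "\<exists>Q\<in>\<Q>. Q \<subseteq> P" using assms(1,2,4)
  proof (induction \<Q>)
    case empty
    then show ?case using P by (auto simp: primeideal_iff)
  next
    case (insert Q \<Q>)
    show ?case
    proof (cases "Q \<subseteq> P")
      case False
      then obtain x where x: "x \<in> Q" "x \<notin> P" by blast
      have "\<Inter>\<Q> \<subseteq> P"
      proof
        fix y assume y: "y \<in> \<Inter>\<Q>"
        have "x * y \<in> Q" using x insert.prems(1)[of Q] unfolding ideal_iff by (simp add: mult.commute)
        moreover have "x * y \<in> R" if "R \<in> \<Q>" for R
          using y that insert.prems(1)[of R] by (simp add: ideal_iff)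
        ultimately have "x * y \<in> P" using insert.prems(2) by blast
        with x P show "y \<in> P" by (auto simp: primeideal_iff)
      qed
      then have "\<exists>Q\<in>\<Q>. Q \<subseteq> P" by (intro insert.IH insert.prems(1)) simp_all
      then show ?thesis by blast
    qed auto
  qed
  with that show ?thesis by blast
qed

lemma irredundant_decomposition_member:
  assumes "irredundant_decomposition I \<P>" "Q \<in> \<P>"
  obtains A where "Q = Idl\<^bsub>mpoly_ring\<^esub> (Var ` A)" "I \<subseteq> Q"
proof -
  from assms have "\<exists>A. Q = Idl\<^bsub>mpoly_ring\<^esub> (Var ` A)" "I = \<Inter>\<P>"
    unfolding irredundant_decomposition_def by simp_all
  with assms(2) that show ?thesis by (metis Inter_lower)
qed

lemma irredundant_decomposition_contains:
  fixes I :: "('v::finite, 'k::field) mpoly set"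
  assumes P: "irredundant_decomposition I \<P>" and "I \<subseteq> Idl\<^bsub>mpoly_ring\<^esub> (Var ` A)"
  obtains Q where "Q \<in> \<P>" "Q \<subseteq> Idl\<^bsub>mpoly_ring\<^esub> (Var ` A)"
proof (rule primeideal_contains_Inter[of \<P> "Idl\<^bsub>mpoly_ring\<^esub> (Var ` A)"])
  fix Q assume "Q \<in> \<P>"
  with P obtain B where "Q = Idl\<^bsub>mpoly_ring\<^esub> (Var ` B)"
    by (rule irredundant_decomposition_member)
  then show "ideal Q mpoly_ring" by (simp only: ideal_Idl_Var)
next
  show "finite \<P>" "\<Inter>\<P> \<subseteq> Idl\<^bsub>mpoly_ring\<^esub> (Var ` A)"
    using assms by (simp_all add: irredundant_decomposition_def)
next
  show "primeideal (Idl\<^bsub>mpoly_ring\<^esub> (Var ` A) :: ('v, 'k) mpoly set) mpoly_ring"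
    by (rule primeideal_Idl_Var)
qed (rule that)

text \<open>Each \<open>R\<close> contains some \<open>S\<close> of the other family, which in turn
  contains some \<open>R'\<close> of the first. Irredundancy forces \<open>R' = R\<close>, hence
  \<open>S = R\<close>. By symmetry the decomposition is unique.\<close>

lemma irredundant_decomposition_subset:
  fixes I :: "('v::finite, 'k::field) mpoly set"
  assumes P: "irredundant_decomposition I \<P>" and Q: "irredundant_decomposition I \<Q>"
  shows "\<P> \<subseteq> \<Q>"
proof
  fix R assume R: "R \<in> \<P>"
  with P obtain A where A: "R = Idl\<^bsub>mpoly_ring\<^esub> (Var ` A)" "I \<subseteq> R"
    by (rule irredundant_decomposition_member)
  obtain S where S: "S \<in> \<Q>" "S \<subseteq> R"
    using irredundant_decomposition_contains[OF Q A(2)[unfolded A(1)]] unfolding A(1) .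
  with Q obtain B where B: "S = Idl\<^bsub>mpoly_ring\<^esub> (Var ` B)" "I \<subseteq> S"
    by (metis irredundant_decomposition_member)
  obtain R' where R': "R' \<in> \<P>" "R' \<subseteq> S"
    using irredundant_decomposition_contains[OF P B(2)[unfolded B(1)]] unfolding B(1) .
  have "R' = R"
  proof (rule ccontr)
    assume "R' \<noteq> R"
    with R' have "R' \<in> \<P> - {R}" by simp
    with R' S have "\<Inter>(\<P> - {R}) = \<Inter>\<P>" by blast
    with P R show False unfolding irredundant_decomposition_def by metis
  qed
  with R' S show "R \<in> \<Q>" by auto
qed

text \<open>This makes the definite description in \<open>symbolic_power\<close> meaningful: a
  subfamily of least cardinality with the same intersection is irredundant.\<close>

lemma The_irredundant_decomposition:
  fixes I :: "('v::finite, 'k::field) mpoly set"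
  assumes "finite \<S>" "\<And>S. S \<in> \<S> \<Longrightarrow> \<exists>A. S = Idl\<^bsub>mpoly_ring\<^esub> (Var ` A)" "I = \<Inter>\<S>"
  shows "irredundant_decomposition I (THE \<P>. irredundant_decomposition I \<P>)"
proof -
  have "\<S> \<subseteq> \<S> \<and> \<Inter>\<S> = I" using assms(3) by simp
  from ex_has_least_nat[of "\<lambda>\<R>. \<R> \<subseteq> \<S> \<and> \<Inter>\<R> = I", OF this, of card]
  obtain \<P> where P: "\<P> \<subseteq> \<S>" "\<Inter>\<P> = I"
    and least: "\<And>\<R>. \<R> \<subseteq> \<S> \<Longrightarrow> \<Inter>\<R> = I \<Longrightarrow> card \<P> \<le> card \<R>"
    by metis
  have fin: "finite \<P>" using P(1) assms(1) by (rule finite_subset)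
  have "\<Inter>(\<P> - {R}) \<noteq> I" if "R \<in> \<P>" for R
  proof
    assume "\<Inter>(\<P> - {R}) = I"
    then have "card \<P> \<le> card (\<P> - {R})" using P(1) by (intro least) auto
    with card_Diff1_less[OF fin that] show False by simp
  qed
  moreover have "\<exists>A. R = Idl\<^bsub>mpoly_ring\<^esub> (Var ` A)" if "R \<in> \<P>" for R
    using P(1) that by (intro assms(2)) (rule subsetD)
  ultimately have *: "irredundant_decomposition I \<P>"
    using P(2) fin unfolding irredundant_decomposition_def by simp
  then show ?thesis
  proof (rule theI)
    fix \<Q> assume "irredundant_decomposition I \<Q>"
    with * show "\<Q> = \<P>" by (intro equalityI irredundant_decomposition_subset)
  qed
qed

section \<open>Vertex covers of weak homomorphisms\<close>

definition hom_exponent :: "('a::finite \<Rightarrow> 'b::finite) \<Rightarrow> ('a \<times> 'b) \<Rightarrow>\<^sub>0 nat"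
  where "hom_exponent \<phi> = (\<Sum>p\<in>UNIV. Poly_Mapping.single (p, \<phi> p) 1)"

lemma lookup_hom_exponent:
  "Poly_Mapping.lookup (hom_exponent \<phi>) v = (if \<phi> (fst v) = snd v then 1 else 0)"
proof -
  have "Poly_Mapping.lookup (hom_exponent \<phi>) v =
      (\<Sum>p\<in>UNIV. if p = fst v then (if \<phi> (fst v) = snd v then 1 else 0) else 0)"
    unfolding hom_exponent_def lookup_sum
    by (intro sum.cong) (auto simp: lookup_single when_def prod_eq_iff)
  then show ?thesis by simp
qed

lemma hom_monomial_eq: "hom_monomial \<phi> = (monomial (hom_exponent \<phi>) :: ('a::finite \<times> 'b::finite, 'k::field) mpoly)"
proof -
  have "(\<Prod>p\<in>A. Var (p, \<phi> p)) =
      (monomial (\<Sum>p\<in>A. Poly_Mapping.single (p, \<phi> p) 1) :: ('a \<times> 'b, 'k) mpoly)" for A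
    using finite[of A] by induction (simp_all add: Var_def mult_single)
  then show ?thesis by (simp add: hom_monomial_def hom_exponent_def)
qed

text \<open>Truncated subtraction is exact here because all exponents along the graph of \<phi> are
  positive.\<close>

lemma hom_exponent_summand:
  fixes \<phi> :: "'a::finite \<Rightarrow> 'b::finite"
  assumes "\<And>p. Poly_Mapping.lookup a (p, \<phi> p) \<noteq> 0"
  shows "a = (a - hom_exponent \<phi>) + hom_exponent \<phi>"
proof (rule poly_mapping_eqI)
  fix v
  show "Poly_Mapping.lookup a v = Poly_Mapping.lookup ((a - hom_exponent \<phi>) + hom_exponent \<phi>) v"
    using assms[of "fst v"] by (cases v) (auto simp: lookup_add lookup_minus lookup_hom_exponent)
qed

text \<open>The generators are squarefree, so divisibility by one of them depends only on the
  support of an exponent.\<close>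

lemma hom_ideal_eq:
  "(hom_ideal E F :: ('a::finite \<times> 'b::finite, 'k::field) mpoly set) =
     {f. \<forall>a\<in>Poly_Mapping.keys f. \<exists>\<phi>\<in>WHom E F. \<forall>p. Poly_Mapping.lookup a (p, \<phi> p) \<noteq> 0}"
proof -
  have *: "(hom_monomial ` WHom E F :: ('a \<times> 'b, 'k) mpoly set) = monomial ` (hom_exponent ` WHom E F)"
    by (auto simp: hom_monomial_eq)
  have summand: "(\<exists>b. a = b + hom_exponent \<phi>) \<longleftrightarrow> (\<forall>p. Poly_Mapping.lookup a (p, \<phi> p) \<noteq> 0)"
    for a and \<phi> :: "'a \<Rightarrow> 'b"
    using hom_exponent_summand by (auto simp: lookup_add lookup_hom_exponent)
  show ?thesis
    unfolding hom_ideal_def * Idl_monomials summand[symmetric] by blast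
qed

lemma ideal_hom_ideal: "ideal (hom_ideal E F :: ('a::finite \<times> 'b::finite, 'k::field) mpoly set) mpoly_ring"
proof -
  interpret R: cring "mpoly_ring :: ('a \<times> 'b, 'k) mpoly ring" by rule
  show ?thesis unfolding hom_ideal_def by (rule R.genideal_ideal) simp
qed

text \<open>These are the vertex covers of the hypergraph whose edges are the graphs of the weak
  homomorphisms.\<close>

definition hom_cover :: "'a::finite set set \<Rightarrow> 'b::finite set set \<Rightarrow> ('a \<times> 'b) set \<Rightarrow> bool"
  where "hom_cover E F C \<longleftrightarrow> (\<forall>\<phi>\<in>WHom E F. \<exists>p. (p, \<phi> p) \<in> C)"

text \<open>Removing single elements suffices as a test, since supersets of covers are
  covers.\<close>

definition minimal_cover :: "'a::finite set set \<Rightarrow> 'b::finite set set \<Rightarrow> ('a \<times> 'b) set \<Rightarrow> bool"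
  where "minimal_cover E F C \<longleftrightarrow> hom_cover E F C \<and> (\<forall>v\<in>C. \<not> hom_cover E F (C - {v}))"

lemma minimal_cover_exists:
  assumes "hom_cover E F C"
  obtains D where "minimal_cover E F D" "D \<subseteq> C"
proof -
  obtain D where D: "hom_cover E F D" "D \<subseteq> C"
    and least: "\<And>D'. hom_cover E F D' \<Longrightarrow> D' \<subseteq> C \<Longrightarrow> card D \<le> card D'"
    using ex_has_least_nat[of "\<lambda>D. hom_cover E F D \<and> D \<subseteq> C" C card] assms by blast
  have "\<not> hom_cover E F (D - {v})" if "v \<in> D" for v
    using least[of "D - {v}"] D card_Diff1_less[OF finite that] by auto
  with D that show ?thesis unfolding minimal_cover_def by blast
qed

lemma hom_ideal_subset_Idl_Var:
  assumes "hom_cover E F C"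
  shows "hom_ideal E F \<subseteq> (Idl\<^bsub>mpoly_ring\<^esub> (Var ` C) :: ('a::finite \<times> 'b::finite, 'k::field) mpoly set)"
proof
  fix f :: "('a \<times> 'b, 'k) mpoly" assume f: "f \<in> hom_ideal E F"
  have "\<exists>v\<in>C. Poly_Mapping.lookup a v \<noteq> 0" if a: "a \<in> Poly_Mapping.keys f" for a
  proof -
    from f a obtain \<phi> where "\<phi> \<in> WHom E F" "\<forall>p. Poly_Mapping.lookup a (p, \<phi> p) \<noteq> 0"
      unfolding hom_ideal_eq by blast
    with assms show ?thesis unfolding hom_cover_def by blast
  qed
  then show "f \<in> Idl\<^bsub>mpoly_ring\<^esub> (Var ` C)" by (simp add: Idl_Var)
qed

text \<open>If the support contained no graph of a weak homomorphism, its complement would be a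
  cover and would contain a minimal cover disjoint from the support.\<close>

lemma WHom_in_support:
  assumes "\<And>C. minimal_cover E F C \<Longrightarrow> \<exists>v\<in>C. Poly_Mapping.lookup a v \<noteq> 0"
  obtains \<phi> where "\<phi> \<in> WHom E F" "\<And>p. Poly_Mapping.lookup a (p, \<phi> p) \<noteq> 0"
proof -
  have "\<not> hom_cover E F {v. Poly_Mapping.lookup a v = 0}"
    using assms by (metis (mono_tags, lifting) mem_Collect_eq minimal_cover_exists subsetD)
  with that show ?thesis unfolding hom_cover_def by blast
qed

lemma hom_ideal_eq_Inter:
  "(hom_ideal E F :: ('a::finite \<times> 'b::finite, 'k::field) mpoly set) =
     \<Inter>((\<lambda>C. Idl\<^bsub>mpoly_ring\<^esub> (Var ` C)) ` {C. minimal_cover E F C})" (is "_ = ?R")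
proof
  show "hom_ideal E F \<subseteq> ?R"
    using hom_ideal_subset_Idl_Var unfolding minimal_cover_def by blast
  show "?R \<subseteq> hom_ideal E F"
  proof
    fix f assume f: "f \<in> ?R"
    have "\<exists>\<phi>\<in>WHom E F. \<forall>p. Poly_Mapping.lookup a (p, \<phi> p) \<noteq> 0" if a: "a \<in> Poly_Mapping.keys f" for a
    proof (rule WHom_in_support[of E F a])
      show "\<exists>v\<in>C. Poly_Mapping.lookup a v \<noteq> 0" if "minimal_cover E F C" for C
        using f a that unfolding Idl_Var by blast
    qed blast
    then show "f \<in> hom_ideal E F" unfolding hom_ideal_eq by blast
  qed
qed

text \<open>By minimality, \<open>I : f\<close> is the prime of the cover \<open>C\<close> for \<open>f\<close> the product of all variables
  outside \<open>C\<close>.\<close>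

lemma minimal_cover_associated:
  assumes "minimal_cover E F C"
  shows "Idl\<^bsub>mpoly_ring\<^esub> (Var ` C) \<in>
    associated_primes mpoly_ring (hom_ideal E F :: ('a::finite \<times> 'b::finite, 'k::field) mpoly set)"
proof -
  define u :: "('a \<times> 'b) \<Rightarrow>\<^sub>0 nat" where "u = (\<Sum>v\<in>-C. Poly_Mapping.single v 1)"
  have u: "Poly_Mapping.lookup u v \<noteq> 0 \<longleftrightarrow> v \<notin> C" for v
    by (auto simp: u_def lookup_sum lookup_single when_def sum.delta)
  have mem: "(\<exists>\<phi>\<in>WHom E F. \<forall>p. Poly_Mapping.lookup (a + u) (p, \<phi> p) \<noteq> 0) \<longleftrightarrow>
      (\<exists>v\<in>C. Poly_Mapping.lookup a v \<noteq> 0)" (is "?L \<longleftrightarrow> ?R") for a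
  proof
    assume ?L
    then obtain \<phi> where \<phi>: "\<phi> \<in> WHom E F" "\<And>p. Poly_Mapping.lookup (a + u) (p, \<phi> p) \<noteq> 0" by blast
    with assms obtain p where p: "(p, \<phi> p) \<in> C" unfolding minimal_cover_def hom_cover_def by blast
    with \<phi>(2)[of p] u[of "(p, \<phi> p)"] show ?R by (auto simp: lookup_add)
  next
    assume ?R
    then obtain v where v: "v \<in> C" "Poly_Mapping.lookup a v \<noteq> 0" by blast
    with assms obtain \<phi> where \<phi>: "\<phi> \<in> WHom E F" "\<And>p. (p, \<phi> p) \<notin> C - {v}"
      unfolding minimal_cover_def hom_cover_def by blast
    have "Poly_Mapping.lookup (a + u) (p, \<phi> p) \<noteq> 0" for p
      using \<phi>(2)[of p] u[of "(p, \<phi> p)"] v(2) by (auto simp: lookup_add)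
    with \<phi>(1) show ?L by blast
  qed
  have keys: "Poly_Mapping.keys (g * monomial u) = (\<lambda>a. a + u) ` Poly_Mapping.keys g"
    for g :: "('a \<times> 'b, 'k) mpoly"
  proof
    show "Poly_Mapping.keys (g * monomial u) \<subseteq> (\<lambda>a. a + u) ` Poly_Mapping.keys g"
      by (auto elim!: keys_mult_subset)
    have "Poly_Mapping.lookup (g * monomial u) (a + u) = Poly_Mapping.lookup g a" for a
      by (subst lookup_mult_unique_sum) auto
    then show "(\<lambda>a. a + u) ` Poly_Mapping.keys g \<subseteq> Poly_Mapping.keys (g * monomial u)"
      by (auto simp: in_keys_iff)
  qed
  have "Idl\<^bsub>mpoly_ring\<^esub> (Var ` C) = {g :: ('a \<times> 'b, 'k) mpoly. g * monomial u \<in> hom_ideal E F}"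
    unfolding hom_ideal_eq Idl_Var mem_Collect_eq keys ball_simps mem ..
  with primeideal_Idl_Var[of C, where ?'k = 'k] show ?thesis
    unfolding associated_primes_def by (auto intro!: exI[of _ "monomial u"])
qed

section \<open>Minimal covers under unmixedness\<close>

lemma const_WHom: "(\<lambda>_. j) \<in> WHom E F"
  by (simp add: WHom_def)

lemma minimal_cover_card:
  fixes E :: "'a::finite set set" and F :: "'b::finite set set"
  assumes "unmixed mpoly_ring (hom_ideal E F :: ('a \<times> 'b, 'k::field) mpoly set)"
    and "minimal_cover E F C"
  shows "card C = CARD('b)"
proof -
  \<comment> \<open>\<open>undefined\<close> serves as an arbitrary vertex of the source graph.
    Minimality holds because the constant map with value \<open>snd v\<close> meets \<open>V\<close>
    only in \<open>v\<close>.\<close>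
  define V :: "('a \<times> 'b) set" where "V = {undefined} \<times> UNIV"
  have "minimal_cover E F V"
    unfolding minimal_cover_def
  proof (intro conjI ballI notI)
    fix v assume v: "v \<in> V" "hom_cover E F (V - {v})"
    then obtain p where "(p, snd v) \<in> V - {v}"
      unfolding hom_cover_def using const_WHom by metis
    with v show False by (auto simp: V_def)
  qed (auto simp: hom_cover_def V_def)
  then have "height mpoly_ring (Idl\<^bsub>mpoly_ring\<^esub> (Var ` C) :: ('a \<times> 'b, 'k) mpoly set) =
      height mpoly_ring (Idl\<^bsub>mpoly_ring\<^esub> (Var ` V) :: ('a \<times> 'b, 'k) mpoly set)"
    using assms minimal_cover_associated unfolding unmixed_def by blast
  then show ?thesis by (simp add: height_Idl_Var V_def)
qed

text \<open>A cover of this size is the graph of a function \<open>f\<close> from \<open>V(H)\<close> to \<open>V(G)\<close>. For an edge \<open>{j, l}\<close> of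
  \<open>H\<close> with \<open>f j \<noteq> f l\<close>, a map into \<open>{j, l}\<close> avoids the cover; hence \<open>f\<close> is constant on the
  components of \<open>H\<close>. If the values of \<open>f\<close> met several components of \<open>G\<close> so that none contained
  them all, a map constant on each component would avoid the cover; hence they lie in one component
  of \<open>G\<close>. As a weak homomorphism sends this component into one component of \<open>H\<close>, it meets the
  cover only once.\<close>

lemma minimal_cover_meets_once:
  fixes E :: "'a::finite set set" and F :: "'b::finite set set"
  assumes min: "minimal_cover E F C" and card: "card C = CARD('b)" and \<phi>: "\<phi> \<in> WHom E F"
  shows "card {v\<in>C. \<phi> (fst v) = snd v} = 1"
proof -
  have cover: "hom_cover E F C" using min by (simp add: minimal_cover_def)
  then have "\<exists>p. (p, j) \<in> C" for j unfolding hom_cover_def using const_WHom by metis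
  then obtain f where f: "\<And>j. (f j, j) \<in> C" by metis
  have C: "C = range (\<lambda>j. (f j, j))"
  proof (rule card_subset_eq[symmetric])
    have "card (range (\<lambda>j. (f j, j))) = CARD('b)" by (rule card_image) (auto intro: injI)
    with card show "card (range (\<lambda>j. (f j, j))) = card C" by simp
  qed (use f in auto)
  have hit: "\<exists>j. \<psi> (f j) = j" if "\<psi> \<in> WHom E F" for \<psi>
    using cover that unfolding hom_cover_def C by auto
  have edge: "f j = f l" if "{j, l} \<in> F" for j l
  proof (rule ccontr)
    assume "f j \<noteq> f l"
    \<comment> \<open>If \<psi> met the cover at \<open>f i\<close>, then either
      \<open>f i = f j\<close> and \<open>i = l\<close>, or \<open>f i\<close> differs from
      \<open>f j\<close> and \<open>i = j\<close>; both are absurd.\<close>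
    define \<psi> where "\<psi> p = (if p = f j then l else j)" for p
    have "\<psi> \<in> WHom E F" using that by (auto simp: WHom_def \<psi>_def insert_commute)
    from hit[OF this] \<open>f j \<noteq> f l\<close> show False by (auto simp: \<psi>_def split: if_splits)
  qed
  define R where "R = {(x, y). {x, y} \<in> E}\<^sup>*"
  define S where "S = {(x, y). {x, y} \<in> F}\<^sup>*"
  have f_S: "f j = f l" if "(j, l) \<in> S" for j l
    using that unfolding S_def by induction (use edge in auto)
  have \<phi>_R: "(\<phi> x, \<phi> y) \<in> S" if "(x, y) \<in> R" for x y
    using that unfolding R_def
  proof induction
    case (step y z)
    then have "\<phi> y = \<phi> z \<or> {\<phi> y, \<phi> z} \<in> F" using \<phi> by (auto simp: WHom_def)
    with step.IH show ?case unfolding S_def by (auto intro: rtrancl_into_rtrancl)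
  qed (simp add: S_def)
  have sym: "sym R" unfolding R_def by (intro sym_rtrancl symI) (auto simp: insert_commute)
  have trans: "trans R" by (simp add: R_def trans_rtrancl)
  obtain q where q: "\<And>j. (q, f j) \<in> R"
  proof (rule ccontr)
    assume "\<not> thesis"
    with that have "\<forall>q. \<exists>j. f j \<notin> R `` {q}" by blast
    \<comment> \<open>The choice depends on the component alone, so it is constant along edges. It
      picks an index whose \<open>f\<close>-value lies outside the component, so a meeting point
      with the cover would be outside its own component.\<close>
    moreover define J where "J Y = (SOME j. f j \<notin> Y)" for Y
    ultimately have J: "f (J (R `` {q})) \<notin> R `` {q}" for q by (metis someI_ex)
    have "(\<lambda>q. J (R `` {q})) \<in> WHom E F"
      unfolding WHom_def
    proof (intro CollectI allI impI disjI1)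
      fix x y assume "{x, y} \<in> E"
      then have "(x, y) \<in> R" by (auto simp: R_def)
      with sym trans have "R `` {x} = R `` {y}" by (blast dest: symD transD)
      then show "J (R `` {x}) = J (R `` {y})" by (rule arg_cong)
    qed
    from hit[OF this] obtain j where "J (R `` {f j}) = j" by blast
    with J[of "f j"] have "(f j, f j) \<notin> R" by auto
    then show False by (simp add: R_def)
  qed
  obtain j where j: "\<phi> (f j) = j" using hit[OF \<phi>] by blast
  have unique: "l = j" if "\<phi> (f l) = l" for l
  proof -
    have "(f l, f j) \<in> R" using q[of l] q[of j] sym trans by (blast dest: symD transD)
    with \<phi>_R have "(l, j) \<in> S" using that j by metis
    then have "f l = f j" by (rule f_S)
    with that j show ?thesis by metis
  qed
  have "{v\<in>C. \<phi> (fst v) = snd v} = {(f j, j)}"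
  proof
    show "{v\<in>C. \<phi> (fst v) = snd v} \<subseteq> {(f j, j)}"
    proof
      fix v assume v: "v \<in> {v\<in>C. \<phi> (fst v) = snd v}"
      then obtain l where l: "v = (f l, l)" unfolding C by blast
      with v have "\<phi> (f l) = l" by simp
      then have "l = j" by (rule unique)
      with l show "v \<in> {(f j, j)}" by blast
    qed
  qed (use f j in auto)
  then show ?thesis by simp
qed

section \<open>Comparison of symbolic and ordinary powers\<close>

lemma monomial_in_hom_ideal_power:
  fixes E :: "'a::finite set set" and F :: "'b::finite set set"
  assumes once: "\<And>C \<phi>. minimal_cover E F C \<Longrightarrow> \<phi> \<in> WHom E F \<Longrightarrow> card {v\<in>C. \<phi> (fst v) = snd v} = 1"
    and "\<And>C. minimal_cover E F C \<Longrightarrow> k \<le> (\<Sum>v\<in>C. Poly_Mapping.lookup a v)"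
  shows "monomial a \<in> ideal_power mpoly_ring (hom_ideal E F :: ('a \<times> 'b, 'k::field) mpoly set) k"
  using assms(2)
proof (induction k arbitrary: a)
  case 0
  show ?case by (simp add: ideal_power_0)
next
  case (Suc k)
  obtain \<phi> where \<phi>: "\<phi> \<in> WHom E F" "\<And>p. Poly_Mapping.lookup a (p, \<phi> p) \<noteq> 0"
  proof (rule WHom_in_support[of E F a])
    fix C assume "minimal_cover E F C"
    from Suc.prems[OF this] show "\<exists>v\<in>C. Poly_Mapping.lookup a v \<noteq> 0"
      by (metis Suc_n_not_le_n le0 order_trans sum.neutral le_zero_eq nat.distinct(1))
  qed blast
  define b where "b = a - hom_exponent \<phi>"
  have a: "a = b + hom_exponent \<phi>" unfolding b_def by (rule hom_exponent_summand[OF \<phi>(2)])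
  have "k \<le> (\<Sum>v\<in>C. Poly_Mapping.lookup b v)" if C: "minimal_cover E F C" for C
  proof -
    \<comment> \<open>The degree in \<open>C\<close> drops by the number of points of the graph of
      \<phi> in \<open>C\<close>. That number being exactly 1 keeps the degree at least
      \<open>k\<close>.\<close>
    have "(\<Sum>v\<in>C. Poly_Mapping.lookup (hom_exponent \<phi>) v) = card {v\<in>C. \<phi> (fst v) = snd v}"
      by (simp add: lookup_hom_exponent sum.If_cases Int_def)
    also have "\<dots> = 1" by (rule once[OF C \<phi>(1)])
    finally show ?thesis using Suc.prems[OF C] by (simp add: a lookup_add sum.distrib)
  qed
  then have "monomial b \<in> ideal_power mpoly_ring (hom_ideal E F :: ('a \<times> 'b, 'k) mpoly set) k"
    by (rule Suc.IH)
  moreover have "monomial (hom_exponent \<phi>) \<in> (hom_ideal E F :: ('a \<times> 'b, 'k) mpoly set)"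
    using \<phi>(1) by (auto simp: hom_ideal_eq lookup_hom_exponent)
  ultimately have "monomial b * monomial (hom_exponent \<phi>) \<in>
      ideal_power mpoly_ring (hom_ideal E F :: ('a \<times> 'b, 'k) mpoly set) (Suc k)"
    unfolding ideal_power_Suc using ideal_prod.prod[where R = mpoly_ring] by fastforce
  then show ?case by (simp add: a mult_single)
qed

text \<open>One inclusion is monotonicity of powers along the components of the decomposition. For
  the other, the prime of each minimal cover contains a component, so elements of the symbolic power
  have degree at least \<open>k\<close> in every minimal cover.\<close>

lemma symbolic_power_hom_ideal:
  fixes E :: "'a::finite set set" and F :: "'b::finite set set"
  assumes "\<And>C \<phi>. minimal_cover E F C \<Longrightarrow> \<phi> \<in> WHom E F \<Longrightarrow> card {v\<in>C. \<phi> (fst v) = snd v} = 1"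
  shows "symbolic_power (hom_ideal E F :: ('a \<times> 'b, 'k::field) mpoly set) k =
    ideal_power mpoly_ring (hom_ideal E F) k"
proof -
  let ?I = "hom_ideal E F :: ('a \<times> 'b, 'k) mpoly set"
  define \<P> where "\<P> = (THE \<P>. irredundant_decomposition ?I \<P>)"
  let ?S = "(\<lambda>C. Idl\<^bsub>mpoly_ring\<^esub> (Var ` C)) ` {C. minimal_cover E F C} :: ('a \<times> 'b, 'k) mpoly set set"
  have P: "irredundant_decomposition ?I \<P>"
    unfolding \<P>_def
  proof (rule The_irredundant_decomposition)
    show "?I = \<Inter>?S" by (rule hom_ideal_eq_Inter)
  qed auto
  have sym: "symbolic_power ?I k = (\<Inter>\<pp>\<in>\<P>. ideal_power mpoly_ring \<pp> k)"
    by (simp add: symbolic_power_def \<P>_def)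
  show ?thesis
  proof
    show "ideal_power mpoly_ring ?I k \<subseteq> symbolic_power ?I k"
      unfolding sym by (intro INT_greatest ideal_power_mono) (use P in \<open>metis irredundant_decomposition_member\<close>)
    show "symbolic_power ?I k \<subseteq> ideal_power mpoly_ring ?I k"
    proof
      fix f assume f: "f \<in> symbolic_power ?I k"
      show "f \<in> ideal_power mpoly_ring ?I k"
      proof (rule monomials_in_ideal[OF ideal_power_ideal[OF ideal_hom_ideal]])
        fix a assume a: "a \<in> Poly_Mapping.keys f"
        show "monomial a \<in> ideal_power mpoly_ring ?I k"
        proof (rule monomial_in_hom_ideal_power[OF assms])
          fix C :: "('a \<times> 'b) set" assume C: "minimal_cover E F C"
          then have "?I \<subseteq> Idl\<^bsub>mpoly_ring\<^esub> (Var ` C)"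
            by (intro hom_ideal_subset_Idl_Var) (simp add: minimal_cover_def)
          from irredundant_decomposition_contains[OF P this]
          obtain Q where "Q \<in> \<P>" and Q: "Q \<subseteq> Idl\<^bsub>mpoly_ring\<^esub> (Var ` C)" .
          from f \<open>Q \<in> \<P>\<close> have "f \<in> ideal_power mpoly_ring Q k"
            unfolding sym by (rule INT_D)
          with ideal_power_mono[OF Q] have "f \<in> ideal_power mpoly_ring (Idl\<^bsub>mpoly_ring\<^esub> (Var ` C)) k"
            by (rule subsetD)
          then show "k \<le> (\<Sum>v\<in>C. Poly_Mapping.lookup a v)"
            using a by (rule ideal_power_Idl_Var)
        qed
      qed
    qed
  qed
qed

theorem proposition2p9:
  fixes E :: "'a::finite set set" and F :: "'b::finite set set" and k :: nat
  assumes "simple_graph E" and "simple_graph F"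
    and "unmixed mpoly_ring (hom_ideal E F :: ('a \<times> 'b, 'k::field) mpoly set)"
    and "k \<ge> 1"
  shows "symbolic_power (hom_ideal E F :: ('a \<times> 'b, 'k) mpoly set) k =
         ideal_power mpoly_ring (hom_ideal E F) k"
proof (rule symbolic_power_hom_ideal)
  fix C :: "('a \<times> 'b) set" and \<phi> assume "minimal_cover E F C" "\<phi> \<in> WHom E F"
  then show "card {v\<in>C. \<phi> (fst v) = snd v} = 1"
    by (intro minimal_cover_meets_once minimal_cover_card[OF assms(3)])
qed

end
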